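(* Let $n\ge 1$ and consider a linear system $\dot y = A y$ with $y\in\mathbb{C}^n$, where $A\in\mathbb{C}^{n\times n}$ is a matrix whose eigenvalues $\lambda\in\mathbb{C}\setminus\mathbb{R}$ lie either all on the positive imaginary axis (every eigenvalue satisfies $\lambda=+i|\lambda|$) or all on the negative imaginary axis (every eigenvalue satisfies $\lambda=-i|\lambda|$). Set $\sigma=+1$ in the first case and $\sigma=-1$ in the second. For $k\in\mathbb{C}$ let $\Phi_k(z)=1+z+kz^2$ be the general stability polynomial of a 2-stage first-order integrator, and let $$Y(k)=\sup\{\,Y\ge 0 : |\Phi_k(\sigma i y)|\le 1 \text{ for all } y\in[0,Y]\,\}.$$ Then the optimal 2-stage first-order stability polynomial for this system has complex (non-real) coefficients: the maximum of $Y(k)$ over all $k\in\mathbb{C}$ is attained, and every $k\in\mathbb{C}$ attaining it satisfies $k\notin\mathbb{R}$.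
   Context: Applying a one-step time integrator with step $\Delta t>0$ to the scalar test equation $\dot y=\lambda y$, $\lambda\in\mathbb{C}$, gives $y(t+\Delta t)=\Phi(\lambda\Delta t)\,y(t)$; $\Phi$ is called the stability function (or stability polynomial) of the integrator, and the set of $z\in\mathbb{C}$ with $|\Phi(z)|\le 1$ is its region of absolute stability. A 2-stage first-order integrator (with possibly complex coefficients) has a stability polynomial of the form $\Phi(z)=1+z+kz^2$ with $k\in\mathbb{C}$. For a system whose eigenvalues all lie on one imaginary half-axis, a 2-stage first-order stability polynomial is called optimal if it allows the maximal stable time step, meaning that the interval of that imaginary half-axis starting at $0$ on which $|\Phi|\le 1$ is as long as possible among all polynomials of this form. *)

theory Defs
  imports Complex_Main "HOL-Computational_Algebra.Polynomial" "Jordan_Normal_Form.Char_Poly"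
begin

definition stab_poly :: "complex \<Rightarrow> complex poly" where
  "stab_poly k = [:1, 1, k:]"

definition stability_region :: "complex poly \<Rightarrow> complex set" where
  "stability_region p = {z. cmod (poly p z) \<le> 1}"

definition stable_lengths :: "real \<Rightarrow> complex \<Rightarrow> real set" where
  "stable_lengths s k =
    {Y. 0 \<le> Y \<and> (\<forall>y\<in>{0..Y}. of_real s * \<i> * of_real y \<in> stability_region (stab_poly k))}"

text \<open>For \<open>s = 1\<close> and \<open>s = -1\<close> the set \<open>stable_lengths s k\<close> is nonempty and bounded above for
  every \<open>k\<close> (lemmas below), so the supremum of real numbers taken here is the true one.\<close>

definition stab_limit :: "real \<Rightarrow> complex \<Rightarrow> real" where
  "stab_limit s k = Sup (stable_lengths s k)"

lemma stable_lengths_nonempty: "0 \<in> stable_lengths s k"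
  by (simp add: stable_lengths_def stability_region_def stab_poly_def)

lemma stable_lengths_bdd_above:
  assumes s: "s = 1 \<or> s = -1"
  shows "bdd_above (stable_lengths s k)"
proof (rule bdd_aboveI)
  fix Y assume "Y \<in> stable_lengths s k"
  then have Y: "0 \<le> Y" and "of_real s * \<i> * of_real Y \<in> stability_region (stab_poly k)"
    by (auto simp: stable_lengths_def)
  define w where "w = of_real s * \<i> * complex_of_real Y"
  have le: "cmod (1 + w + k * w\<^sup>2) \<le> 1"
    using \<open>_ \<in> stability_region _\<close>
    by (simp add: stability_region_def stab_poly_def w_def algebra_simps power2_eq_square)
  have w: "cmod w = Y"
    using Y s by (auto simp: w_def norm_mult)
  show "Y \<le> max 1 (3 / cmod k)"
  proof (cases "k = 0")
    case True
    have "1 + Y\<^sup>2 = (cmod (1 + w))\<^sup>2"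
      using s by (auto simp: w_def cmod_power2)
    also have "\<dots> \<le> 1"
      using le True by (simp add: abs_square_le_1)
    finally show ?thesis by simp
  next
    case False
    show ?thesis
    proof (cases "Y \<le> 1")
      case True
      then show ?thesis by simp
    next
      case gt: False
      have "cmod k * Y\<^sup>2 = cmod ((1 + w + k * w\<^sup>2) - (1 + w))"
        using w by (simp add: norm_mult norm_power)
      also have "\<dots> \<le> 1 + (1 + Y)"
        using norm_triangle_ineq4[of "1 + w + k * w\<^sup>2" "1 + w"] norm_triangle_ineq[of 1 w] le w
        by simp
      also have "\<dots> \<le> 3 * Y" using gt by simp
      finally have "(cmod k * Y) * Y \<le> 3 * Y" by (simp add: power2_eq_square mult.assoc)
      then have "cmod k * Y \<le> 3" using gt by simp
      then have "Y \<le> 3 / cmod k" using False by (simp add: field_simps)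
      then show ?thesis by simp
    qed
  qed
qed

end

(* Write k = a + i b. On the half-axis z = s i y one has
   |Phi_k(z)|^2 - 1 = y^2 q(y) with q(y) = (1 - 2 a) - 2 s b y + |k|^2 y^2.
   Stability for small y forces q(0) <= 0, that is a >= 1/2, and the real part of Phi_k(z)
   being 1 - a y^2 >= -1 then gives y <= 2. The bound 2 is attained at k = (1 + s i) / 2, where
   q(y) = y (y - 2) / 2. For real k, q(y) <= 0 reads a^2 y^2 <= 2 a - 1 <= a^2, so that y <= 1. *)
theory Submission
  imports Defs
begin

text \<open>Squaring the modulus turns stability into a polynomial inequality. Keeping the factor
  \<open>y\<^sup>2\<close> makes the equivalence hold at \<open>y = 0\<close> too. Since
  \<open>s * s = 1\<close>, one computation serves both half-axes, and \<open>s\<close> survives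
  only in the linear term.\<close>

lemma stability_region_imag_iff:
  assumes s: "s = 1 \<or> s = -1"
  shows "of_real s * \<i> * of_real y \<in> stability_region (stab_poly k) \<longleftrightarrow>
    y\<^sup>2 * (1 - 2 * Re k - 2 * s * Im k * y + ((Re k)\<^sup>2 + (Im k)\<^sup>2) * y\<^sup>2) \<le> 0"
proof -
  define P where "P = poly (stab_poly k) (of_real s * \<i> * of_real y)"
  have s2: "s * s = 1"
    using s by auto
  have "Re P = 1 - (s * s) * (Re k * y\<^sup>2)" "Im P = s * y - (s * s) * (Im k * y\<^sup>2)"
    by (simp_all add: P_def stab_poly_def algebra_simps power2_eq_square)
  then have "(cmod P)\<^sup>2 = (1 - Re k * y\<^sup>2)\<^sup>2 + (s * y - Im k * y\<^sup>2)\<^sup>2"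
    by (simp add: cmod_power2 s2)
  also have "\<dots> = 1 - 2 * Re k * y\<^sup>2 + (Re k)\<^sup>2 * y^4 + (s * s) * y\<^sup>2
      - 2 * s * Im k * y^3 + (Im k)\<^sup>2 * y^4"
    by (simp add: algebra_simps power2_eq_square power3_eq_cube power4_eq_xxxx)
  also have "\<dots> = 1 + y\<^sup>2 * (1 - 2 * Re k - 2 * s * Im k * y + ((Re k)\<^sup>2 + (Im k)\<^sup>2) * y\<^sup>2)"
    by (simp add: s2 algebra_simps power2_eq_square power3_eq_cube power4_eq_xxxx)
  finally have "(cmod P)\<^sup>2 \<le> 1 \<longleftrightarrow>
      y\<^sup>2 * (1 - 2 * Re k - 2 * s * Im k * y + ((Re k)\<^sup>2 + (Im k)\<^sup>2) * y\<^sup>2) \<le> 0"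
    by simp
  moreover have "cmod P \<le> 1 \<longleftrightarrow> (cmod P)\<^sup>2 \<le> 1"
    by (simp add: abs_square_le_1)
  ultimately show ?thesis
    by (simp add: stability_region_def P_def)
qed

lemma stable_lengths_quadratic:
  assumes s: "s = 1 \<or> s = -1" and Y: "Y \<in> stable_lengths s k" and y: "0 < y" "y \<le> Y"
  shows "1 - 2 * Re k - 2 * s * Im k * y + ((Re k)\<^sup>2 + (Im k)\<^sup>2) * y\<^sup>2 \<le> 0"
proof -
  have "of_real s * \<i> * of_real y \<in> stability_region (stab_poly k)"
    using Y y by (simp add: stable_lengths_def)
  then show ?thesis
    using y by (simp add: stability_region_imag_iff[OF s] mult_le_0_iff)
qed

text \<open>A positive constant term \<open>1 - 2 * Re k\<close> would keep the quadratic positive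
  near 0, so some small \<open>y\<close> would already be unstable.\<close>

lemma stable_lengths_Re_ge:
  assumes s: "s = 1 \<or> s = -1" and Y: "Y \<in> stable_lengths s k" "0 < Y"
  shows "1 / 2 \<le> Re k"
proof (rule ccontr)
  assume "\<not> 1 / 2 \<le> Re k"
  then have c: "0 < 1 - 2 * Re k" by simp
  \<comment> \<open>With this \<open>y\<close> the linear term takes at most
    \<open>1 - 2 * Re k - y\<close> from the constant term, so the quadratic is at least
    \<open>y > 0\<close>. The \<open>+ 1\<close> supplies this margin and keeps the denominator
    positive when \<open>Im k = 0\<close>.\<close>
  define y where "y = min Y ((1 - 2 * Re k) / (2 * \<bar>Im k\<bar> + 1))"
  have y: "0 < y" "y \<le> Y"
    using c Y by (auto simp: y_def)
  have "y * (2 * \<bar>Im k\<bar> + 1) \<le> 1 - 2 * Re k"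
    by (simp add: y_def pos_le_divide_eq[symmetric])
  then have "2 * \<bar>Im k\<bar> * y + y \<le> 1 - 2 * Re k"
    by (simp add: algebra_simps)
  moreover have "2 * s * Im k * y \<le> 2 * \<bar>Im k\<bar> * y"
    using s y by (intro mult_right_mono) auto
  moreover have "0 \<le> ((Re k)\<^sup>2 + (Im k)\<^sup>2) * y\<^sup>2"
    by simp
  ultimately show False
    using stable_lengths_quadratic[OF s Y(1) y] y(1) by linarith
qed

text \<open>The argument is imaginary and its square is real, so \<open>Im k\<close> does not enter
  the real part, and the real part at the endpoint \<open>Y\<close> settles the bound.\<close>

lemma stable_lengths_le_2:
  assumes s: "s = 1 \<or> s = -1" and Y: "Y \<in> stable_lengths s k"
  shows "Y \<le> 2"
proof (cases "0 < Y")
  case True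
  define P where "P = poly (stab_poly k) (of_real s * \<i> * of_real Y)"
  have "cmod P \<le> 1"
    using Y by (auto simp: stable_lengths_def stability_region_def P_def)
  moreover have "Re P = 1 - Re k * Y\<^sup>2"
    using s by (auto simp: P_def stab_poly_def algebra_simps power2_eq_square)
  ultimately have "Re k * Y\<^sup>2 \<le> 2"
    using abs_Re_le_cmod[of P] by linarith
  moreover have "1 / 2 * Y\<^sup>2 \<le> Re k * Y\<^sup>2"
    using stable_lengths_Re_ge[OF s Y True] by (intro mult_right_mono) auto
  ultimately have "Y\<^sup>2 \<le> 2\<^sup>2"
    by simp
  then show ?thesis
    by (rule power2_le_imp_le) simp
qed simp

lemma stable_lengths_real_le_1:
  assumes s: "s = 1 \<or> s = -1" and Y: "Y \<in> stable_lengths s k" and k: "k \<in> \<real>"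
  shows "Y \<le> 1"
proof (cases "0 < Y")
  case True
  have a: "0 < (Re k)\<^sup>2"
    using stable_lengths_Re_ge[OF s Y True] by simp
  have "(Re k)\<^sup>2 * Y\<^sup>2 \<le> 2 * Re k - 1"
    using stable_lengths_quadratic[OF s Y True] k by (simp add: complex_is_Real_iff)
  \<comment> \<open>This is \<open>(Re k - 1)\<^sup>2 \<ge> 0\<close>, with equality for
    \<open>Re k = 1\<close>.\<close>
  also have "\<dots> \<le> (Re k)\<^sup>2 * 1"
    using zero_le_power2[of "Re k - 1"] by (simp add: power2_diff)
  finally have "Y\<^sup>2 \<le> 1\<^sup>2"
    using a by (simp add: mult_le_cancel_left_pos)
  then show ?thesis
    by (rule power2_le_imp_le) simp
qed simp

text \<open>\<open>Re k = 1 / 2\<close> removes the constant term of the quadratic, and giving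
  \<open>Im k\<close> the sign of \<open>s\<close> makes the linear term equal to \<open>- y\<close>
  on either half-axis.\<close>

lemma two_in_stable_lengths:
  assumes s: "s = 1 \<or> s = -1"
  shows "2 \<in> stable_lengths s (Complex (1 / 2) (s / 2))"
proof -
  have "y\<^sup>2 * (- (s * s) * y + (1 / 4 + (s * s) / 4) * y\<^sup>2) \<le> 0" if "0 \<le> y" "y \<le> 2" for y :: real
  proof -
    have "y\<^sup>2 * (- (s * s) * y + (1 / 4 + (s * s) / 4) * y\<^sup>2) = y\<^sup>2 * (y * (y - 2) / 2)"
      using s by (auto simp: field_simps power2_eq_square)
    also have "\<dots> \<le> 0"
      using that by (intro mult_nonneg_nonpos divide_nonpos_pos) auto
    finally show ?thesis .
  qed
  then show ?thesis
    by (auto simp: stable_lengths_def stability_region_imag_iff[OF s] power2_eq_square)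
qed

lemma stab_limit_le:
  assumes "\<And>Y. Y \<in> stable_lengths s k \<Longrightarrow> Y \<le> c"
  shows "stab_limit s k \<le> c"
  unfolding stab_limit_def using stable_lengths_nonempty assms by (intro cSup_least) auto

theorem theorem3p1:
  fixes n :: nat and A :: "complex mat" and \<sigma> :: real
  assumes "n \<ge> 1"
    and "A \<in> carrier_mat n n"
    and "\<And>l. eigenvalue A l \<Longrightarrow> l \<notin> \<real>"
    and "(\<sigma> = 1 \<and> (\<forall>l. eigenvalue A l \<longrightarrow> l = \<i> * of_real (cmod l))) \<or>
         (\<sigma> = -1 \<and> (\<forall>l. eigenvalue A l \<longrightarrow> l = - \<i> * of_real (cmod l)))"
  shows "(\<exists>k. \<forall>k'. stab_limit \<sigma> k' \<le> stab_limit \<sigma> k) \<and>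
         (\<forall>k. (\<forall>k'. stab_limit \<sigma> k' \<le> stab_limit \<sigma> k) \<longrightarrow> k \<notin> \<real>)"
proof -
  have s: "\<sigma> = 1 \<or> \<sigma> = -1"
    using assms(4) by auto
  define k0 where "k0 = Complex (1 / 2) (\<sigma> / 2)"
  have le2: "stab_limit \<sigma> k \<le> 2" for k
    by (rule stab_limit_le[OF stable_lengths_le_2[OF s]])
  have ge2: "2 \<le> stab_limit \<sigma> k0"
    unfolding stab_limit_def k0_def
    by (rule cSup_upper[OF two_in_stable_lengths[OF s] stable_lengths_bdd_above[OF s]])
  \<comment> \<open>A maximizer must do at least as well as \<open>k0\<close>, which reaches 2,
    whereas real coefficients stop at 1.\<close>
  have "k \<notin> \<real>" if opt: "\<forall>k'. stab_limit \<sigma> k' \<le> stab_limit \<sigma> k" for k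
  proof
    assume "k \<in> \<real>"
    then have "stab_limit \<sigma> k \<le> 1"
      by (intro stab_limit_le stable_lengths_real_le_1[OF s])
    with opt ge2 show False
      using spec[OF opt, of k0] by linarith
  qed
  \<comment> \<open>\<open>k0\<close> attains the maximum because its value reaches the bound 2
    valid for every \<open>k\<close>.\<close>
  with le2 ge2 show ?thesis
    by (meson order_trans)
qed

end
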